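(* Let $n\ge 0$ be an integer, let $\Omega\subset\mathbb{R}^2$ be the open unit disk, and let $\Omega$ be partitioned into $n+2$ sectors $\Delta_1,\dots,\Delta_{n+2}$ by pairwise non-collinear rays $v_1,\dots,v_{n+2}$ emanating from the origin. Let functions $f_1,\dots,f_{n+2}$ be $n+1$ times continuously differentiable on $\Omega$, and let $F$ be defined piecewise on the sectors by $F|_{\Delta_j}:=f_j$, $j=1,\dots,n+2$. If $F\in C^n(\Omega)$, then $F$ has all derivatives of order $n+1$ at the origin; that is, $F\in C^{n+1}(\mathbf{0})$.
   Context: The rays $v_1,\dots,v_{n+2}$ emanate from the origin $\mathbf{0}=(0,0)$ and are positioned clockwise in this order. Pairwise non-collinear means that direction vectors of any two of the rays are linearly independent (so no two rays coincide and no two are opposite). For $1\le j\le n+1$, $\Delta_j$ is the (closed in $\Omega$) sector of $\Omega$ swept clockwise from $v_j$ to $v_{j+1}$, and $\Delta_{n+2}$ is the sector swept clockwise from $v_{n+2}$ to $v_1$. $F\in C^n(\Omega)$ means that $F$ is well defined and $n$ times continuously differentiable on $\Omega$ (for $n=0$: continuous). $F\in C^{n+1}(\mathbf{0})$ means that all partial derivatives of $F$ up to order $n+1$ exist at the origin in the sense that the pieces agree there: for all integers $k,l\ge 0$ with $k+l\le n+1$, $$\frac{\partial^{k+l} f_1}{\partial x^k\partial y^l}(\mathbf{0})=\frac{\partial^{k+l} f_2}{\partial x^k\partial y^l}(\mathbf{0})=\cdots=\frac{\partial^{k+l} f_{n+2}}{\partial x^k\partial y^l}(\mathbf{0}).$$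 *)

theory Defs
  imports "HOL-Analysis.Analysis"
begin

text \<open>The plane is \<^typ>\<open>real \<times> real\<close>, whose norm is the Euclidean one.\<close>

abbreviation unit_disk :: "(real \<times> real) set" where
  "unit_disk \<equiv> ball 0 1"

definition partial_x :: "(real \<times> real \<Rightarrow> real) \<Rightarrow> real \<times> real \<Rightarrow> real" where
  "partial_x f = (\<lambda>(x, y). deriv (\<lambda>t. f (t, y)) x)"

definition partial_y :: "(real \<times> real \<Rightarrow> real) \<Rightarrow> real \<times> real \<Rightarrow> real" where
  "partial_y f = (\<lambda>(x, y). deriv (\<lambda>t. f (x, t)) y)"

definition mixed_partial :: "nat \<Rightarrow> nat \<Rightarrow> (real \<times> real \<Rightarrow> real) \<Rightarrow> real \<times> real \<Rightarrow> real" where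
  "mixed_partial k l f = (partial_x ^^ k) ((partial_y ^^ l) f)"

text \<open>To be used for open \<open>S\<close> only: then membership depends on the values of \<open>f\<close> on \<open>S\<close> alone, and
  differentiability makes the partial derivatives the components of the Frechet derivative.\<close>

primrec C_k_on :: "nat \<Rightarrow> (real \<times> real \<Rightarrow> real) \<Rightarrow> (real \<times> real) set \<Rightarrow> bool" where
  "C_k_on 0 f S \<longleftrightarrow> continuous_on S f"
| "C_k_on (Suc k) f S \<longleftrightarrow>
     (\<forall>p\<in>S. f differentiable (at p)) \<and> C_k_on k (partial_x f) S \<and> C_k_on k (partial_y f) S"

text \<open>The vectors \<open>v 1, \<dots>, v N\<close> span rays from the origin that are met clockwise in this order, within
  one full turn. Polar angles decrease clockwise; \<open>\<theta> j\<close> is the polar angle of \<open>v j\<close>, chosen so that the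
  sequence \<open>\<theta>\<close> is decreasing. Every clockwise ordered family of rays admits such a choice.\<close>

definition clockwise_rays :: "nat \<Rightarrow> (nat \<Rightarrow> real \<times> real) \<Rightarrow> (nat \<Rightarrow> real) \<Rightarrow> bool" where
  "clockwise_rays N v \<theta> \<longleftrightarrow>
     (\<forall>j\<in>{1..N}. \<exists>r>0. v j = r *\<^sub>R (cos (\<theta> j), sin (\<theta> j))) \<and>
     (\<forall>j\<in>{1..<N}. \<theta> (Suc j) < \<theta> j) \<and>
     \<theta> 1 - 2 * pi < \<theta> N"

text \<open>The inequality \<open>v i \<noteq> v j\<close> is needed because \<open>{v i, v j}\<close> collapses to a singleton for equal vectors.\<close>

definition pairwise_noncollinear :: "nat \<Rightarrow> (nat \<Rightarrow> real \<times> real) \<Rightarrow> bool" where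
  "pairwise_noncollinear N v \<longleftrightarrow>
     (\<forall>i\<in>{1..N}. \<forall>j\<in>{1..N}. i \<noteq> j \<longrightarrow> v i \<noteq> v j \<and> independent {v i, v j})"

text \<open>The part of the unit disk swept clockwise from polar angle \<open>a\<close> down to polar angle \<open>b\<close>,
  both boundary rays included. It may be larger than a half disk.\<close>

definition swept :: "real \<Rightarrow> real \<Rightarrow> (real \<times> real) set" where
  "swept a b = {p \<in> unit_disk. \<exists>r t. 0 \<le> r \<and> b \<le> t \<and> t \<le> a \<and> p = r *\<^sub>R (cos t, sin t)}"

text \<open>One turn after \<open>\<theta> 1\<close>, the first ray is met again at angle \<open>\<theta> 1 - 2 * pi\<close>.\<close>

definition sector :: "nat \<Rightarrow> (nat \<Rightarrow> real) \<Rightarrow> nat \<Rightarrow> (real \<times> real) set" where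
  "sector N \<theta> j = (if j < N then swept (\<theta> j) (\<theta> (Suc j)) else swept (\<theta> N) (\<theta> 1 - 2 * pi))"

text \<open>The function with pieces \<open>f 1, \<dots>, f N\<close> is of class \<open>C\<^sup>m\<close> at the origin: all partial derivatives
  of the pieces up to order \<open>m\<close> agree there.\<close>

definition piecewise_C_at_origin :: "nat \<Rightarrow> nat \<Rightarrow> (nat \<Rightarrow> real \<times> real \<Rightarrow> real) \<Rightarrow> bool" where
  "piecewise_C_at_origin m N f \<longleftrightarrow>
     (\<forall>k l. k + l \<le> m \<longrightarrow>
        (\<forall>i\<in>{1..N}. \<forall>j\<in>{1..N}. mixed_partial k l (f i) (0, 0) = mixed_partial k l (f j) (0, 0)))"

end

theory Submission
  imports Defs
begin

text \<open>
  \<^bold>\<open>Orders up to \<open>n\<close>.\<close> Inside a sector \<open>F\<close> and the piece \<open>f j\<close> are the same function, so their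
  partial derivatives of order at most \<open>n\<close> agree there, and by continuity they still agree on the
  boundary rays and at the origin (\<open>mixed_partial_eq_on_boundary_rays\<close>).

  \<^bold>\<open>Order \<open>n + 1\<close>.\<close> Two pieces that meet along a ray of direction \<open>(a, b)\<close> have the same partial
  derivatives of order \<open>n\<close> on that ray. Differentiating along the ray at the origin, the jumps
  \<open>d k\<close> of the derivatives \<open>\<partial>\<^sub>x\<^sup>k \<partial>\<^sub>y\<^sup>n\<^sup>+\<^sup>1\<^sup>-\<^sup>k\<close> across the ray satisfy \<open>a * d (k + 1) + b * d k = 0\<close>
  for \<open>k \<le> n\<close>, that is, \<open>d\<close> is a multiple of the sequence \<open>a\<^sup>n\<^sup>+\<^sup>1\<^sup>-\<^sup>k (- b)\<^sup>k\<close>. Going once around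
  the origin, the \<open>n + 2\<close> jumps add up to zero. For pairwise independent directions, the
  \<open>n + 2\<close> sequences above are the rows of an invertible (homogeneous) Vandermonde matrix, so
  every jump vanishes. \<open>jumps_vanish\<close> carries out this last step by elimination, without a
  determinant: the operator \<open>d \<mapsto> a * d (k + 1) + b * d k\<close> that belongs to one ray annihilates the
  jump across that ray and preserves the recurrences of the others, so that one ray and one
  equation can be removed at a time.

  The identity for the jumps treats a \<open>y\<close>-derivative of \<open>\<partial>\<^sub>x\<^sup>k \<partial>\<^sub>y\<^sup>l f\<close> as \<open>\<partial>\<^sub>x\<^sup>k \<partial>\<^sub>y\<^sup>l\<^sup>+\<^sup>1 f\<close>, which rests
  on the symmetry of second derivatives (\<open>partial_y_partial_x_commute\<close>).
\<close>

section \<open>Partial derivatives and the classes \<open>C\<^sup>k\<close>\<close>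

lemma has_derivative_imp_partial:
  assumes "(f has_derivative f') (at p)"
  shows "partial_x f p = f' (1, 0)" "partial_y f p = f' (0, 1)"
    and "((\<lambda>t. f (t, snd p)) has_real_derivative partial_x f p) (at (fst p))"
    and "((\<lambda>t. f (fst p, t)) has_real_derivative partial_y f p) (at (snd p))"
proof -
  interpret f': bounded_linear f'
    using assms by (rule has_derivative_bounded_linear)
  have dx: "((\<lambda>t. f (t, snd p)) has_real_derivative f' (1, 0)) (at (fst p))"
  proof -
    have "((\<lambda>t. (t, snd p)) has_derivative (\<lambda>h. (h, 0))) (at (fst p))"
      by (intro has_derivative_Pair has_derivative_ident has_derivative_const)
    from has_derivative_compose[OF this, of f f', unfolded prod.collapse, OF assms]
    have "((\<lambda>t. f (t, snd p)) has_derivative (\<lambda>h. f' (h, 0))) (at (fst p))"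
      .
    moreover have "(\<lambda>h. f' (h, 0)) = (*) (f' (1, 0))"
    proof
      show "f' (h, 0) = f' (1, 0) * h" for h
        using f'.scaleR[of h "(1, 0)"] by simp
    qed
    ultimately show ?thesis
      by (simp only: has_field_derivative_def)
  qed
  have dy: "((\<lambda>t. f (fst p, t)) has_real_derivative f' (0, 1)) (at (snd p))"
  proof -
    have "((\<lambda>t. (fst p, t)) has_derivative (\<lambda>h. (0, h))) (at (snd p))"
      by (intro has_derivative_Pair has_derivative_ident has_derivative_const)
    from has_derivative_compose[OF this, of f f', unfolded prod.collapse, OF assms]
    have "((\<lambda>t. f (fst p, t)) has_derivative (\<lambda>h. f' (0, h))) (at (snd p))"
      .
    moreover have "(\<lambda>h. f' (0, h)) = (*) (f' (0, 1))"
    proof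
      show "f' (0, h) = f' (0, 1) * h" for h
        using f'.scaleR[of h "(0, 1)"] by simp
    qed
    ultimately show ?thesis
      by (simp only: has_field_derivative_def)
  qed
  show px: "partial_x f p = f' (1, 0)"
    using dx by (simp add: partial_x_def case_prod_beta DERIV_imp_deriv)
  show py: "partial_y f p = f' (0, 1)"
    using dy by (simp add: partial_y_def case_prod_beta DERIV_imp_deriv)
  show "((\<lambda>t. f (t, snd p)) has_real_derivative partial_x f p) (at (fst p))"
    using dx px by simp
  show "((\<lambda>t. f (fst p, t)) has_real_derivative partial_y f p) (at (snd p))"
    using dy py by simp
qed

lemma differentiable_has_derivative_partials:
  assumes "f differentiable (at p)"
  shows "(f has_derivative (\<lambda>h. fst h * partial_x f p + snd h * partial_y f p)) (at p)"
proof -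
  obtain f' where f': "(f has_derivative f') (at p)"
    using assms by (auto simp: differentiable_def)
  interpret f': bounded_linear f'
    using f' by (rule has_derivative_bounded_linear)
  have "f' h = fst h * partial_x f p + snd h * partial_y f p" for h
    using f'.add[of "(fst h, 0)" "(0, snd h)"] f'.scaleR[of "fst h" "(1, 0)"]
      f'.scaleR[of "snd h" "(0, 1)"] has_derivative_imp_partial(1,2)[OF f'] by simp
  then have "f' = (\<lambda>h. fst h * partial_x f p + snd h * partial_y f p)"
    by blast
  with f' show ?thesis
    by simp
qed

lemma partial_cong_on_open:
  assumes "open U" "\<And>p. p \<in> U \<Longrightarrow> f p = g p" "p \<in> U"
  shows "partial_x f p = partial_x g p" "partial_y f p = partial_y g p"
proof -
  obtain x y where p: "p = (x, y)"
    by fastforce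
  have "open ((\<lambda>t. (t, y)) -` U)" "open ((\<lambda>t. (x, t)) -` U)"
    by (auto intro!: continuous_open_vimage assms(1) continuous_intros)
  then have "\<forall>\<^sub>F t in nhds x. f (t, y) = g (t, y)" "\<forall>\<^sub>F t in nhds y. f (x, t) = g (x, t)"
    using assms p by (auto simp: eventually_nhds)
  then show "partial_x f p = partial_x g p" "partial_y f p = partial_y g p"
    by (auto simp: p partial_x_def partial_y_def intro: deriv_cong_ev)
qed

lemma mixed_partial_simps [simp]:
  "mixed_partial 0 0 f = f"
  "mixed_partial 0 (Suc l) f = partial_y (mixed_partial 0 l f)"
  "mixed_partial (Suc k) l f = partial_x (mixed_partial k l f)"
  by (simp_all add: mixed_partial_def)

lemma mixed_partial_cong_on_open:
  assumes "open U" "\<And>p. p \<in> U \<Longrightarrow> f p = g p" "p \<in> U"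
  shows "mixed_partial k l f p = mixed_partial k l g p"
proof -
  have l: "mixed_partial 0 l f p = mixed_partial 0 l g p" if "p \<in> U" for p l
    using that
    by (induction l arbitrary: p) (auto simp: assms(2) intro: partial_cong_on_open(2)[OF assms(1)])
  show ?thesis
    using assms(3)
    by (induction k arbitrary: p) (auto simp: l intro: partial_cong_on_open(1)[OF assms(1)])
qed

lemma C_k_on_mixed_partial:
  assumes "C_k_on (k + l + m) f S"
  shows "C_k_on m (mixed_partial k l f) S"
proof -
  have l: "C_k_on m (mixed_partial 0 l f) S" if "C_k_on (l + m) f S" for m
    using that
  proof (induction l arbitrary: m)
    case (Suc l)
    then have "C_k_on (Suc m) (mixed_partial 0 l f) S"
      by (metis add_Suc_shift)
    then show ?case
      by simp
  qed simp
  show ?thesis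
    using assms
  proof (induction k arbitrary: m)
    case (Suc k)
    then have "C_k_on (Suc m) (mixed_partial k l f) S"
      by (metis add_Suc add_Suc_right)
    then show ?case
      by simp
  qed (use l in simp)
qed

lemma C_k_on_imp_continuous_on: "C_k_on k f S \<Longrightarrow> continuous_on S f"
  by (cases k) (auto simp: differentiable_imp_continuous_within continuous_at_imp_continuous_on)

lemma C_k_on_mono:
  assumes "C_k_on m f S" "k \<le> m"
  shows "C_k_on k f S"
  using assms
proof (induction k arbitrary: m f)
  case 0
  then show ?case
    by (simp add: C_k_on_imp_continuous_on)
next
  case (Suc k)
  then obtain m' where "m = Suc m'" "k \<le> m'"
    by (cases m) auto
  with Suc show ?case
    by auto
qed

section \<open>Symmetry of second derivatives\<close>

text \<open>The mean value theorem is applied to the horizontal variable of \<open>f (s, y + h) - f (s, y)\<close>, and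
  then to the vertical variable of its derivative.\<close>

lemma second_difference_mean_value:
  fixes f :: "real \<times> real \<Rightarrow> real"
  assumes "0 < h"
    and fx: "\<And>s t. s \<in> {x..x + h} \<Longrightarrow> t \<in> {y..y + h} \<Longrightarrow>
      ((\<lambda>s. f (s, t)) has_real_derivative g (s, t)) (at s)"
    and gy: "\<And>s t. s \<in> {x..x + h} \<Longrightarrow> t \<in> {y..y + h} \<Longrightarrow>
      ((\<lambda>t. g (s, t)) has_real_derivative k (s, t)) (at t)"
  shows "\<exists>s\<in>{x..x + h}. \<exists>t\<in>{y..y + h}.
    f (x + h, y + h) - f (x + h, y) - f (x, y + h) + f (x, y) = h * h * k (s, t)"
proof -
  have "\<exists>s. x < s \<and> s < x + h \<and>
      (f (x + h, y + h) - f (x + h, y)) - (f (x, y + h) - f (x, y))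
        = (x + h - x) * (g (s, y + h) - g (s, y))"
    using \<open>0 < h\<close> by (intro MVT2) (auto intro!: derivative_intros fx)
  then obtain s where "x < s" "s < x + h"
    "f (x + h, y + h) - f (x + h, y) - (f (x, y + h) - f (x, y)) = h * (g (s, y + h) - g (s, y))"
    by auto
  then have s: "s \<in> {x..x + h}"
    "f (x + h, y + h) - f (x + h, y) - f (x, y + h) + f (x, y) = h * (g (s, y + h) - g (s, y))"
    by auto
  have "\<exists>t. y < t \<and> t < y + h \<and> g (s, y + h) - g (s, y) = (y + h - y) * k (s, t)"
    using \<open>0 < h\<close> s(1) by (intro MVT2) (auto intro!: gy)
  then obtain t where "y < t" "t < y + h" "g (s, y + h) - g (s, y) = h * k (s, t)"
    by auto
  with s show ?thesis
    by (intro bexI[of _ s] bexI[of _ t]) auto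
qed

text \<open>Both mixed second derivatives are limits of the same second difference quotient over shrinking
  squares: in each square the quotient is a value of either of them.\<close>

lemma partial_y_partial_x_commute:
  assumes "open S" "C_k_on 2 f S" "p \<in> S"
  shows "partial_y (partial_x f) p = partial_x (partial_y f) p"
proof -
  obtain x y where p: "p = (x, y)"
    by fastforce
  have diff: "f differentiable (at q)" "partial_x f differentiable (at q)"
    "partial_y f differentiable (at q)" if "q \<in> S" for q
    using assms(2) that by (auto simp: numeral_2_eq_2)
  have cont: "isCont (partial_y (partial_x f)) p" "isCont (partial_x (partial_y f)) p"
    using assms by (auto simp: numeral_2_eq_2 continuous_on_eq_continuous_at)
  have "\<bar>partial_y (partial_x f) p - partial_x (partial_y f) p\<bar> \<le> 0 + e" if "e > 0" for e
  proof -
    obtain d1 where d1: "d1 > 0"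
      "\<And>q. dist q p < d1 \<Longrightarrow> \<bar>partial_y (partial_x f) q - partial_y (partial_x f) p\<bar> < e / 2"
      using cont(1) half_gt_zero[OF \<open>e > 0\<close>] unfolding continuous_at_eps_delta dist_real_def
      by blast
    obtain d2 where d2: "d2 > 0"
      "\<And>q. dist q p < d2 \<Longrightarrow> \<bar>partial_x (partial_y f) q - partial_x (partial_y f) p\<bar> < e / 2"
      using cont(2) half_gt_zero[OF \<open>e > 0\<close>] unfolding continuous_at_eps_delta dist_real_def
      by blast
    obtain d3 where d3: "d3 > 0" "\<And>q. dist q p < d3 \<Longrightarrow> q \<in> S"
      using \<open>open S\<close> \<open>p \<in> S\<close> unfolding open_dist by blast
    define h where "h = min d1 (min d2 d3) / 3"
    have "h > 0"
      using d1 d2 d3 by (simp add: h_def)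
    have near: "dist (s, t) p < d1" "dist (s, t) p < d2" "(s, t) \<in> S"
      if "s \<in> {x..x + h}" "t \<in> {y..y + h}" for s t
    proof -
      have "dist (s, t) p \<le> \<bar>s - x\<bar> + \<bar>t - y\<bar>"
        unfolding p dist_Pair_Pair dist_real_def by (rule sqrt_sum_squares_le_sum_abs[THEN order_trans]) simp
      also have "\<dots> \<le> 2 * h"
        using that by auto
      also have "\<dots> < min d1 (min d2 d3)"
        using \<open>h > 0\<close> by (simp only: h_def)
      finally show "dist (s, t) p < d1" "dist (s, t) p < d2" "(s, t) \<in> S"
        using d3(2) by (simp_all only: min_less_iff_conj)
    qed
    have "\<exists>s\<in>{x..x + h}. \<exists>t\<in>{y..y + h}.
        f (x + h, y + h) - f (x + h, y) - f (x, y + h) + f (x, y)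
          = h * h * partial_y (partial_x f) (s, t)"
      using \<open>h > 0\<close>
    proof (rule second_difference_mean_value[where g = "partial_x f"])
      fix s t assume "s \<in> {x..x + h}" "t \<in> {y..y + h}"
      then have "(s, t) \<in> S"
        by (rule near(3))
      from has_derivative_imp_partial(3)[OF differentiable_has_derivative_partials, OF diff(1)[OF this]]
        has_derivative_imp_partial(4)[OF differentiable_has_derivative_partials, OF diff(2)[OF this]]
      show "((\<lambda>s. f (s, t)) has_real_derivative partial_x f (s, t)) (at s)"
        "((\<lambda>t. partial_x f (s, t)) has_real_derivative partial_y (partial_x f) (s, t)) (at t)"
        by simp_all
    qed
    then obtain s t where st: "s \<in> {x..x + h}" "t \<in> {y..y + h}"
      "f (x + h, y + h) - f (x + h, y) - f (x, y + h) + f (x, y)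
        = h * h * partial_y (partial_x f) (s, t)"
      by blast
    \<comment> \<open>The same with the two variables exchanged.\<close>
    have "\<exists>t'\<in>{y..y + h}. \<exists>s'\<in>{x..x + h}.
        (f \<circ> prod.swap) (y + h, x + h) - (f \<circ> prod.swap) (y + h, x) - (f \<circ> prod.swap) (y, x + h)
          + (f \<circ> prod.swap) (y, x) = h * h * (partial_x (partial_y f) \<circ> prod.swap) (t', s')"
      using \<open>h > 0\<close>
    proof (rule second_difference_mean_value[where g = "partial_y f \<circ> prod.swap"])
      fix t s assume "t \<in> {y..y + h}" "s \<in> {x..x + h}"
      then have "(s, t) \<in> S"
        by (intro near(3))
      from has_derivative_imp_partial(4)[OF differentiable_has_derivative_partials, OF diff(1)[OF this]]
        has_derivative_imp_partial(3)[OF differentiable_has_derivative_partials, OF diff(3)[OF this]]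
      show "((\<lambda>t. (f \<circ> prod.swap) (t, s)) has_real_derivative (partial_y f \<circ> prod.swap) (t, s)) (at t)"
        "((\<lambda>s. (partial_y f \<circ> prod.swap) (t, s)) has_real_derivative
            (partial_x (partial_y f) \<circ> prod.swap) (t, s)) (at s)"
        by simp_all
    qed
    then obtain s' t' where st': "s' \<in> {x..x + h}" "t' \<in> {y..y + h}"
      "f (x + h, y + h) - f (x + h, y) - f (x, y + h) + f (x, y)
        = h * h * partial_x (partial_y f) (s', t')"
      by auto
    have "partial_y (partial_x f) (s, t) = partial_x (partial_y f) (s', t')"
      using st(3) st'(3) \<open>h > 0\<close> by simp
    then show ?thesis
      using d1(2)[OF near(1)[OF st(1,2)]] d2(2)[OF near(2)[OF st'(1,2)]] by linarith
  qed
  then have "\<bar>partial_y (partial_x f) p - partial_x (partial_y f) p\<bar> \<le> 0"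
    by (rule field_le_epsilon)
  then show ?thesis
    by simp
qed

text \<open>In \<^const>\<open>mixed_partial\<close> the \<open>x\<close>-derivatives are taken last, so a further \<open>y\<close>-derivative has to be
  moved past them one at a time.\<close>

lemma partial_y_mixed_partial:
  assumes "open S" "C_k_on (Suc (k + l)) f S" "p \<in> S"
  shows "partial_y (mixed_partial k l f) p = mixed_partial k (Suc l) f p"
  using assms(2,3)
proof (induction k arbitrary: p)
  case 0
  then show ?case
    by simp
next
  case (Suc k)
  have "C_k_on 2 (mixed_partial k l f) S"
    using Suc.prems(1) by (intro C_k_on_mixed_partial) (simp add: numeral_2_eq_2 del: C_k_on.simps)
  then have "partial_y (mixed_partial (Suc k) l f) p = partial_x (partial_y (mixed_partial k l f)) p"
    using partial_y_partial_x_commute[OF assms(1)] Suc.prems(2) by simp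
  also have "\<dots> = partial_x (mixed_partial k (Suc l) f) p"
  proof (rule partial_cong_on_open(1)[OF assms(1) _ Suc.prems(2)])
    have "C_k_on (Suc (k + l)) f S"
      using Suc.prems(1) by (rule C_k_on_mono) simp
    then show "partial_y (mixed_partial k l f) q = mixed_partial k (Suc l) f q" if "q \<in> S" for q
      using Suc.IH that by blast
  qed
  finally show ?case
    by simp
qed

section \<open>Agreement on the rays\<close>

text \<open>The two expressions are the determinants of \<open>p\<close> with the unit vectors at angles \<open>b\<close> and \<open>a\<close>. For
  \<open>b < a \<le> b + pi\<close> their signs say that \<open>p\<close> lies strictly between these two directions; in this form
  the wedge is visibly open.\<close>

definition open_wedge :: "real \<Rightarrow> real \<Rightarrow> (real \<times> real) set" where
  "open_wedge a b = {p \<in> unit_disk.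
     0 < cos b * snd p - sin b * fst p \<and> 0 < fst p * sin a - snd p * cos a}"

lemma open_open_wedge: "open (open_wedge a b)"
proof -
  have "open_wedge a b = unit_disk \<inter> {p. 0 < cos b * snd p - sin b * fst p}
      \<inter> {p. 0 < fst p * sin a - snd p * cos a}"
    by (auto simp: open_wedge_def)
  also have "open \<dots>"
    by (intro open_Int open_ball open_Collect_less continuous_intros)
  finally show ?thesis .
qed

text \<open>After a rotation by \<open>- b\<close> the point lies in the upper half plane, where it has a polar angle
  \<open>\<tau>\<close> between \<open>0\<close> and \<open>pi\<close>; the second determinant bounds \<open>\<tau>\<close> by \<open>a - b\<close>.\<close>

lemma open_wedge_subset_swept:
  assumes "b < a" "b' \<le> b" "a \<le> a'" "a - b \<le> pi"
  shows "open_wedge a b \<subseteq> swept a' b'"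
proof
  fix p assume "p \<in> open_wedge a b"
  then obtain x y where p: "p = (x, y)" "p \<in> unit_disk"
    and 1: "0 < cos b * y - sin b * x" and 2: "0 < x * sin a - y * cos a"
    by (cases p) (auto simp: open_wedge_def)
  define X where "X = x * cos b + y * sin b"
  define Y where "Y = cos b * y - sin b * x"
  define r where "r = sqrt (X\<^sup>2 + Y\<^sup>2)"
  have "Y > 0"
    using 1 by (simp add: Y_def)
  then have r: "r > 0" "r\<^sup>2 = X\<^sup>2 + Y\<^sup>2"
    by (simp_all add: r_def add_nonneg_pos)
  have "(X / r)\<^sup>2 + (Y / r)\<^sup>2 = 1"
    using r \<open>Y > 0\<close> by (simp add: power_divide flip: add_divide_distrib)
  then obtain \<tau> where \<tau>: "0 \<le> \<tau>" "\<tau> \<le> pi" "X / r = cos \<tau>" "Y / r = sin \<tau>"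
    using sincos_total_pi[of "Y / r" "X / r"] \<open>Y > 0\<close> r(1) by auto
  then have XY: "X = r * cos \<tau>" "Y = r * sin \<tau>"
    using r(1) by (auto simp: field_simps)
  have "x = X * cos b - Y * sin b" "y = X * sin b + Y * cos b"
    unfolding X_def Y_def using sin_cos_squared_add3[of b] by algebra+
  then have x: "x = r * cos (b + \<tau>)" and y: "y = r * sin (b + \<tau>)"
    by (simp_all add: XY cos_add sin_add algebra_simps)
  have "x * sin a - y * cos a = r * sin (a - (b + \<tau>))"
    by (simp add: x y sin_diff algebra_simps)
  then have "0 < sin (a - (b + \<tau>))"
    using 2 r(1) by (simp add: zero_less_mult_iff)
  moreover have "0 \<le> sin (b + \<tau> - a)" if "b + \<tau> \<ge> a"
    using that \<open>b < a\<close> \<tau>(2) by (intro sin_ge_zero) auto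
  moreover have "sin (b + \<tau> - a) = - sin (a - (b + \<tau>))"
    by (metis minus_diff_eq sin_minus)
  ultimately have "b + \<tau> \<le> a"
    by force
  then have "p = r *\<^sub>R (cos (b + \<tau>), sin (b + \<tau>))" "0 \<le> r" "b' \<le> b + \<tau>" "b + \<tau> \<le> a'"
    using p(1) x y r(1) \<tau>(1) assms(2,3) by auto
  then show "p \<in> swept a' b'"
    using p(2) unfolding swept_def by blast
qed


text \<open>A small shift along the bisector moves the point into the open wedge, even from a bounding ray
  or from the apex.\<close>

lemma ray_in_closure_open_wedge:
  assumes "b < a" "a - b < pi" "c \<in> {b..a}" "0 \<le> t" "t < 1"
  shows "t *\<^sub>R (cos c, sin c) \<in> closure (open_wedge a b)"
  unfolding closure_approachable
proof (intro allI impI)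
  fix e :: real assume "e > 0"
  define \<delta> where "\<delta> = min e (1 - t) / 2"
  have \<delta>: "0 < \<delta>" "\<delta> < e" "t + \<delta> < 1"
    using \<open>e > 0\<close> assms by (auto simp: \<delta>_def min_def field_simps)
  define m where "m = (a + b) / 2"
  have m: "b < m" "m < a" "m - b < pi" "a - m < pi"
    using assms(1,2) by (simp_all add: m_def field_simps)
  define q where "q = t *\<^sub>R (cos c, sin c) + \<delta> *\<^sub>R (cos m, sin m)"
  have norm_unit: "norm (cos s, sin s) = 1" for s :: real
    by (simp add: norm_prod_def)
  have "dist q (t *\<^sub>R (cos c, sin c)) = \<delta>"
    using \<delta>(1) norm_unit[of m] by (simp add: q_def dist_norm del: scaleR_Pair)
  then have "dist q (t *\<^sub>R (cos c, sin c)) < e"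
    using \<delta>(2) by simp
  moreover have "q \<in> open_wedge a b"
  proof -
    have "norm q \<le> t + \<delta>"
      using norm_triangle_ineq[of "t *\<^sub>R (cos c, sin c)" "\<delta> *\<^sub>R (cos m, sin m)"] assms(4) \<delta>(1)
        norm_unit[of m] norm_unit[of c] by (simp add: q_def del: scaleR_Pair)
    then have "q \<in> unit_disk"
      using \<delta>(3) by simp
    moreover have "0 < t * sin (c - b) + \<delta> * sin (m - b)"
      using assms \<delta>(1) m by (intro add_nonneg_pos mult_nonneg_nonneg mult_pos_pos sin_ge_zero sin_gt_zero) auto
    then have "0 < cos b * snd q - sin b * fst q"
      by (simp add: q_def sin_diff algebra_simps)
    moreover have "0 < t * sin (a - c) + \<delta> * sin (a - m)"
      using assms \<delta>(1) m by (intro add_nonneg_pos mult_nonneg_nonneg mult_pos_pos sin_ge_zero sin_gt_zero) auto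
    then have "0 < fst q * sin a - snd q * cos a"
      by (simp add: q_def sin_diff algebra_simps)
    ultimately show ?thesis
      by (simp add: open_wedge_def)
  qed
  ultimately show "\<exists>q\<in>open_wedge a b. dist q (t *\<^sub>R (cos c, sin c)) < e"
    by blast
qed

lemma continuous_on_eq_at_closure_point:
  fixes f g :: "'a::metric_space \<Rightarrow> 'b::t2_space"
  assumes "continuous_on S f" "continuous_on S g" "U \<subseteq> S"
    and "\<And>x. x \<in> U \<Longrightarrow> f x = g x" "p \<in> S" "p \<in> closure U"
  shows "f p = g p"
proof -
  obtain x where x: "\<And>n. x n \<in> U" "x \<longlonglongrightarrow> p"
    using assms(6) by (auto simp: closure_sequential)
  have "(f \<circ> x) \<longlonglongrightarrow> f p" "(g \<circ> x) \<longlonglongrightarrow> g p"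
    using assms x unfolding continuous_on_sequentially by blast+
  moreover have "f \<circ> x = g \<circ> x"
    using assms(4) x(1) by auto
  ultimately show ?thesis
    using LIMSEQ_unique by metis
qed

text \<open>Only a wedge around the ray of angle \<open>c\<close> is needed. Its width is kept below \<open>pi\<close>, because the
  sector itself may be wider than a half disk.\<close>

lemma mixed_partial_eq_on_boundary_rays:
  assumes "C_k_on n f unit_disk" "C_k_on n g unit_disk" "k + l \<le> n"
    and "\<And>p. p \<in> swept a b \<Longrightarrow> f p = g p" "b < a" "c \<in> {b..a}" "0 \<le> t" "t < 1"
  shows "mixed_partial k l f (t *\<^sub>R (cos c, sin c)) = mixed_partial k l g (t *\<^sub>R (cos c, sin c))"
proof -
  define a' b' where "a' = min a (c + 1)" and "b' = max b (c - 1)"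
  have ab: "b' < a'" "a' - b' < pi" "c \<in> {b'..a'}" "b \<le> b'" "a' \<le> a"
    using assms(5,6) pi_gt3 by (auto simp: a'_def b'_def)
  have sub: "open_wedge a' b' \<subseteq> swept a b"
    using ab by (intro open_wedge_subset_swept) auto
  show ?thesis
  proof (rule continuous_on_eq_at_closure_point[where S = unit_disk and U = "open_wedge a' b'"
        and f = "mixed_partial k l f" and g = "mixed_partial k l g"])
    show "continuous_on unit_disk (mixed_partial k l f)" "continuous_on unit_disk (mixed_partial k l g)"
      using assms(1-3)
      by (auto intro!: C_k_on_imp_continuous_on[where k = 0] C_k_on_mixed_partial elim: C_k_on_mono
          simp del: C_k_on.simps)
    show "open_wedge a' b' \<subseteq> unit_disk"
      by (auto simp: open_wedge_def)
    show "t *\<^sub>R (cos c, sin c) \<in> closure (open_wedge a' b')"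
      using ab assms(7,8) by (intro ray_in_closure_open_wedge)
    have "norm (cos c, sin c) = 1"
      by (simp add: norm_prod_def)
    then show "t *\<^sub>R (cos c, sin c) \<in> unit_disk"
      using assms(7,8) by (simp del: scaleR_Pair)
    show "mixed_partial k l f p = mixed_partial k l g p" if "p \<in> open_wedge a' b'" for p
      using assms(4) sub that by (intro mixed_partial_cong_on_open[OF open_open_wedge]) auto
  qed
qed

text \<open>Both sides are the one-sided derivative at \<open>0\<close> along the ray spanned by \<open>u\<close>.\<close>

lemma directional_derivative_eq_of_eq_on_ray:
  assumes "f differentiable (at 0)" "g differentiable (at 0)"
    and eq: "\<And>t. 0 \<le> t \<Longrightarrow> t < 1 \<Longrightarrow> f (t *\<^sub>R u) = g (t *\<^sub>R u)"
  shows "fst u * partial_x f 0 + snd u * partial_y f 0 = fst u * partial_x g 0 + snd u * partial_y g 0"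
    (is "?D f = ?D g")
proof -
  have D: "((\<lambda>t. h (t *\<^sub>R u)) has_real_derivative ?D h) (at 0)" if h: "h differentiable (at 0)" for h
  proof -
    have "((\<lambda>t. t *\<^sub>R u) has_derivative (\<lambda>t. t *\<^sub>R u)) (at 0)"
      by (auto intro!: derivative_eq_intros)
    from has_derivative_compose[OF this, of h, unfolded scale_zero_left,
        OF differentiable_has_derivative_partials[OF h]]
    have "((\<lambda>t. h (t *\<^sub>R u)) has_derivative
        (\<lambda>t. fst (t *\<^sub>R u) * partial_x h 0 + snd (t *\<^sub>R u) * partial_y h 0)) (at 0)" .
    moreover have "(\<lambda>t. fst (t *\<^sub>R u) * partial_x h 0 + snd (t *\<^sub>R u) * partial_y h 0) = (*) (?D h)"
      by (simp add: fun_eq_iff algebra_simps)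
    ultimately show ?thesis
      by (simp only: has_field_derivative_def)
  qed
  have "((\<lambda>t. f (t *\<^sub>R u) - g (t *\<^sub>R u)) has_real_derivative ?D f - ?D g) (at 0)"
    using assms by (intro derivative_intros D)
  then have "((\<lambda>t. (f (t *\<^sub>R u) - g (t *\<^sub>R u)) / t) \<longlongrightarrow> ?D f - ?D g) (at 0)"
    using eq[of 0] by (simp add: has_field_derivative_iff)
  then have "((\<lambda>t. (f (t *\<^sub>R u) - g (t *\<^sub>R u)) / t) \<longlongrightarrow> ?D f - ?D g) (at_right 0)"
    by (rule tendsto_mono[OF at_le, rotated]) simp
  moreover have "\<forall>\<^sub>F t in at_right 0. (f (t *\<^sub>R u) - g (t *\<^sub>R u)) / t = 0"
    using eventually_at_right_real[of 0 1] by (auto elim!: eventually_mono simp: eq)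
  ultimately have "((\<lambda>t :: real. 0) \<longlongrightarrow> ?D f - ?D g) (at_right 0)"
    by (simp cong: tendsto_cong)
  then show ?thesis
    by (simp add: tendsto_const_iff)
qed

section \<open>The jumps around the origin\<close>

text \<open>Induction on the number of rays. For a ray \<open>m\<close>, the sequences
  \<open>d' i k = a m * d i (k + 1) + b m * d i k\<close> of the other rays satisfy the hypotheses with one term
  less, since \<open>d' m = 0\<close>. Once \<open>d' i = 0\<close>, consecutive terms of \<open>d i\<close> solve two independent linear
  equations.\<close>

lemma jumps_vanish:
  fixes a b :: "'i \<Rightarrow> 'a::field" and d :: "'i \<Rightarrow> nat \<Rightarrow> 'a"
  assumes "finite A"
    and "\<And>i j. i \<in> A \<Longrightarrow> j \<in> A \<Longrightarrow> i \<noteq> j \<Longrightarrow> a i * b j \<noteq> a j * b i"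
    and "\<And>i k. i \<in> A \<Longrightarrow> Suc k < card A \<Longrightarrow> a i * d i (Suc k) + b i * d i k = 0"
    and "\<And>k. k < card A \<Longrightarrow> (\<Sum>i\<in>A. d i k) = 0"
    and "i \<in> A" "k < card A"
  shows "d i k = 0"
  using assms
proof (induction A arbitrary: d i k rule: finite_induct)
  case empty
  then show ?case
    by simp
next
  case (insert m A)
  note card = card_insert_disjoint[OF insert.hyps(1,2)]
  have others: "d i k = 0" if "i \<in> A" "k < Suc (card A)" for i k
  proof -
    define d' where "d' i k = a m * d i (Suc k) + b m * d i k" for i k
    have d': "d' i k = 0" if "i \<in> A" "k < card A" for i k
    proof (rule insert.IH[where d = d'])
      show "a i * b j \<noteq> a j * b i" if "i \<in> A" "j \<in> A" "i \<noteq> j" for i j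
        using insert.prems(1) that by blast
      show "a i * d' i (Suc k) + b i * d' i k = 0" if "i \<in> A" "Suc k < card A" for i k
      proof -
        have "a i * d' i (Suc k) + b i * d' i k
            = a m * (a i * d i (Suc (Suc k)) + b i * d i (Suc k)) + b m * (a i * d i (Suc k) + b i * d i k)"
          by (simp add: d'_def algebra_simps)
        then show ?thesis
          using insert.prems(2)[of i k] insert.prems(2)[of i "Suc k"] that by (simp add: card)
      qed
      show "(\<Sum>i\<in>A. d' i k) = 0" if "k < card A" for k
      proof -
        have "(\<Sum>i\<in>A. d' i k) = (\<Sum>i\<in>insert m A. d' i k)"
          using insert.hyps insert.prems(2)[of m k] that by (simp add: card d'_def)
        also have "\<dots> = a m * (\<Sum>i\<in>insert m A. d i (Suc k)) + b m * (\<Sum>i\<in>insert m A. d i k)"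
          unfolding d'_def sum.distrib sum_distrib_left ..
        also have "\<dots> = 0"
          using insert.prems(3)[of k] insert.prems(3)[of "Suc k"] that by (simp only: card) simp
        finally show ?thesis .
      qed
    qed (use that in auto)
    have pair: "d i k = 0 \<and> d i (Suc k) = 0" if "i \<in> A" "k < card A" for i k
    proof -
      have 1: "a i * d i (Suc k) + b i * d i k = 0" "a m * d i (Suc k) + b m * d i k = 0"
        using insert.prems(2)[of i k] d'[of i k] that by (auto simp: card d'_def)
      have 2: "a i * b m - a m * b i \<noteq> 0"
        using insert.prems(1)[of i m] insert.hyps(2) that by auto
      have "(a i * b m - a m * b i) * d i k
          = a i * (a m * d i (Suc k) + b m * d i k) - a m * (a i * d i (Suc k) + b i * d i k)"
        "(a i * b m - a m * b i) * d i (Suc k)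
          = b m * (a i * d i (Suc k) + b i * d i k) - b i * (a m * d i (Suc k) + b m * d i k)"
        by (simp_all add: algebra_simps)
      then show ?thesis
        unfolding 1 using 2 by simp
    qed
    show ?thesis
    proof (cases k)
      case 0
      have "card A > 0"
        using that(1) insert.hyps(1) card_gt_0_iff by blast
      then show ?thesis
        using pair[OF that(1), of 0] 0 by simp
    next
      case (Suc k')
      then show ?thesis
        using pair[OF that(1), of k'] that(2) by simp
    qed
  qed
  show ?case
  proof (cases "i = m")
    case True
    have "(\<Sum>i\<in>insert m A. d i k) = d m k"
      using insert.hyps insert.prems(5) others by (simp add: card)
    then show ?thesis
      using True insert.prems(3,5) by simp
  qed (use others insert.prems(4,5) card in auto)
qed

lemma not_collinear_angles:
  assumes "pairwise_noncollinear N v" "i \<in> {1..N}" "j \<in> {1..N}" "i \<noteq> j"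
    and v: "v i = r *\<^sub>R (cos \<alpha>, sin \<alpha>)" "v j = s *\<^sub>R (cos \<beta>, sin \<beta>)" "s > 0"
  shows "cos \<alpha> * sin \<beta> \<noteq> cos \<beta> * sin \<alpha>"
proof
  assume *: "cos \<alpha> * sin \<beta> = cos \<beta> * sin \<alpha>"
  \<comment> \<open>\<open>\<kappa>\<close> is \<open>cos (\<alpha> - \<beta>)\<close>, the component of the first unit vector along the second.\<close>
  define \<kappa> where "\<kappa> = cos \<alpha> * cos \<beta> + sin \<alpha> * sin \<beta>"
  have "cos \<alpha> = \<kappa> * cos \<beta>" "sin \<alpha> = \<kappa> * sin \<beta>"
    unfolding \<kappa>_def using * sin_cos_squared_add3[of \<beta>] by algebra+
  then have "v i = (r * \<kappa> / s) *\<^sub>R v j"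
    using v by simp
  then have "v i \<in> span {v j}"
    by (metis span_base span_scale singletonI)
  moreover have "v i \<noteq> v j" "independent {v i, v j}"
    using assms(1-4) by (auto simp: pairwise_noncollinear_def)
  ultimately show False
    by (simp add: independent_insert)
qed

theorem theorem7:
  fixes n :: nat
    and v :: "nat \<Rightarrow> real \<times> real"
    and \<theta> :: "nat \<Rightarrow> real"
    and f :: "nat \<Rightarrow> real \<times> real \<Rightarrow> real"
    and F :: "real \<times> real \<Rightarrow> real"
  assumes "clockwise_rays (n + 2) v \<theta>"
    and "pairwise_noncollinear (n + 2) v"
    and "\<And>j. j \<in> {1..n + 2} \<Longrightarrow> C_k_on (n + 1) (f j) unit_disk"
    and "\<And>j p. j \<in> {1..n + 2} \<Longrightarrow> p \<in> sector (n + 2) \<theta> j \<Longrightarrow> F p = f j p"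
    and "C_k_on n F unit_disk"
  shows "piecewise_C_at_origin (n + 1) (n + 2) f"
proof -
  define N where "N = n + 2"
  note assms = assms[folded N_def]
  \<comment> \<open>Sector \<open>j\<close> lies between the angles \<open>\<phi> j\<close> and \<open>\<theta> j\<close>; ray \<open>i\<close> separates the sectors
    \<open>pre i\<close> and \<open>i\<close>.\<close>
  define \<phi> where "\<phi> j = (if j < N then \<theta> (Suc j) else \<theta> 1 - 2 * pi)" for j
  define pre where "pre i = (if i = 1 then N else i - 1)" for i :: nat
  define ray where "ray t i = t *\<^sub>R (cos (\<theta> i), sin (\<theta> i))" for t :: real and i
  have pre: "pre i \<in> {1..N}" if "i \<in> {1..N}" for i
    using that by (auto simp: pre_def N_def)
  have sector: "sector N \<theta> j = swept (\<theta> j) (\<phi> j)" "\<phi> j < \<theta> j" if "j \<in> {1..N}" for j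
    using assms(1) that by (auto simp: sector_def \<phi>_def clockwise_rays_def not_less)
  have \<phi>_pre: "(cos (\<phi> (pre i)), sin (\<phi> (pre i))) = (cos (\<theta> i), sin (\<theta> i))" if "i \<in> {1..N}" for i
    using that by (auto simp: \<phi>_def pre_def cos_diff sin_diff)

  have F_eq: "mixed_partial k l F (t *\<^sub>R (cos c, sin c)) = mixed_partial k l (f j) (t *\<^sub>R (cos c, sin c))"
    if "j \<in> {1..N}" "k + l \<le> n" "0 \<le> t" "t < 1" "c \<in> {\<phi> j..\<theta> j}" for j k l t c
  proof (rule mixed_partial_eq_on_boundary_rays[OF assms(5)])
    show "C_k_on n (f j) unit_disk"
      using assms(3)[OF that(1)] by (rule C_k_on_mono) simp
    show "F p = f j p" if "p \<in> swept (\<theta> j) (\<phi> j)" for p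
      using assms(4) sector(1) that \<open>j \<in> {1..N}\<close> by blast
  qed (use that sector in auto)
  have low: "mixed_partial k l (f j) 0 = mixed_partial k l F 0" if "j \<in> {1..N}" "k + l \<le> n" for j k l
    using F_eq[OF that, of 0 "\<theta> j"] sector(2)[OF that(1)] by (simp del: scaleR_Pair)
  have on_ray: "mixed_partial k l (f i) (ray t i) = mixed_partial k l (f (pre i)) (ray t i)"
    if "i \<in> {1..N}" "k + l \<le> n" "0 \<le> t" "t < 1" for i k l t
    using F_eq[OF that, of "\<theta> i"] F_eq[OF pre[OF that(1)] that(2-4), of "\<phi> (pre i)"]
      sector(2)[OF that(1)] sector(2)[OF pre[OF that(1)]] \<phi>_pre[OF that(1)]
    by (simp add: ray_def del: scaleR_Pair prod.inject)

  define H where "H j k = mixed_partial k (n + 1 - k) (f j) 0" for j k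
  define d where "d i k = H i k - H (pre i) k" for i k
  have jump: "cos (\<theta> i) * d i (Suc k) + sin (\<theta> i) * d i k = 0" if i: "i \<in> {1..N}" and "k \<le> n" for i k
  proof -
    let ?M = "\<lambda>j. mixed_partial k (n - k) (f j)"
    have "C_k_on 1 (?M j) unit_disk" if "j \<in> {1..N}" for j
      using assms(3)[OF that] \<open>k \<le> n\<close> by (intro C_k_on_mixed_partial) (simp del: C_k_on.simps)
    then have diff: "?M j differentiable (at 0)" if "j \<in> {1..N}" for j
      using that by simp
    have partials: "partial_x (?M j) 0 = H j (Suc k)" "partial_y (?M j) 0 = H j k" if "j \<in> {1..N}" for j
      using partial_y_mixed_partial[OF open_ball, of k "n - k" "f j" 0 1 0] assms(3)[OF that] \<open>k \<le> n\<close>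
      by (simp_all add: H_def Suc_diff_le del: C_k_on.simps)
    have "fst (ray 1 i) * partial_x (?M i) 0 + snd (ray 1 i) * partial_y (?M i) 0
        = fst (ray 1 i) * partial_x (?M (pre i)) 0 + snd (ray 1 i) * partial_y (?M (pre i)) 0"
      using on_ray[OF i, of k "n - k"] \<open>k \<le> n\<close> diff i pre
      by (intro directional_derivative_eq_of_eq_on_ray) (auto simp: ray_def)
    then show ?thesis
      using partials i pre by (simp add: ray_def d_def algebra_simps)
  qed
  have d0: "d i k = 0" if "i \<in> {1..N}" "k \<le> n + 1" for i k
  proof (rule jumps_vanish[where A = "{1..N}" and a = "\<lambda>i. cos (\<theta> i)" and b = "\<lambda>i. sin (\<theta> i)"])
    show "cos (\<theta> i) * sin (\<theta> j) \<noteq> cos (\<theta> j) * sin (\<theta> i)"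
      if ij: "i \<in> {1..N}" "j \<in> {1..N}" "i \<noteq> j" for i j
    proof -
      obtain r s where "v i = r *\<^sub>R (cos (\<theta> i), sin (\<theta> i))" "v j = s *\<^sub>R (cos (\<theta> j), sin (\<theta> j))" "s > 0"
        using assms(1) ij unfolding clockwise_rays_def by metis
      then show ?thesis
        by (rule not_collinear_angles[OF assms(2) ij])
    qed
    show "cos (\<theta> i) * d i (Suc k) + sin (\<theta> i) * d i k = 0" if "i \<in> {1..N}" "Suc k < card {1..N}" for i k
      using that by (intro jump) (auto simp: N_def)
    show "(\<Sum>i\<in>{1..N}. d i k) = 0" for k
    proof -
      have "(\<Sum>i\<in>{1..N}. d i k) = d 1 k + (\<Sum>i\<in>{Suc 1..N}. d i k)"
        by (intro sum.atLeast_Suc_atMost) (simp add: N_def)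
      also have "(\<Sum>i\<in>{Suc 1..N}. d i k) = (\<Sum>i\<in>{Suc 1..N}. H i k - H (i - 1) k)"
        by (intro sum.cong) (auto simp: d_def pre_def)
      also have "\<dots> = H N k - H 1 k"
        by (rule sum_telescope'') (simp add: N_def)
      finally show ?thesis
        by (simp add: d_def pre_def)
    qed
  qed (use that in \<open>auto simp: N_def\<close>)
  have top: "H j k = H 1 k" if "j \<in> {1..N}" "k \<le> n + 1" for j k
  proof -
    have "j \<ge> 1" "j \<le> N"
      using that by auto
    then show ?thesis
    proof (induction j rule: nat_induct_at_least)
      case (Suc j)
      then show ?case
        using d0[of "Suc j" k] that(2) by (simp add: d_def pre_def)
    qed simp
  qed

  show ?thesis
    unfolding piecewise_C_at_origin_def N_def[symmetric] zero_prod_def[symmetric]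
  proof (intro allI impI ballI)
    fix k l i j assume kl: "k + l \<le> n + 1" and ij: "i \<in> {1..N}" "j \<in> {1..N}"
    show "mixed_partial k l (f i) 0 = mixed_partial k l (f j) 0"
    proof (cases "k + l \<le> n")
      case True
      then show ?thesis
        using low ij by simp
    next
      case False
      then have "l = n + 1 - k" "k \<le> n + 1"
        using kl by auto
      then show ?thesis
        using top[of i k] top[of j k] ij by (simp add: H_def)
    qed
  qed
qed

end
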